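(* Let $n$ be an integer with $n \geq 7$ and $n \equiv 3 \pmod 4$. Then $s_{\max}(\mathbb{F}_2^n) \leq 2^{\frac{n+1}{2}}-3$.
   Context: A subset $S \subseteq \mathbb{F}_2^n$ is called a Sidon set if the equation $x+y=z+w$ is never satisfied for any four distinct $x,y,z,w \in S$ (equivalently, no four distinct points of $S$ have zero sum). $s_{\max}(\mathbb{F}_2^n)$ denotes the largest size of a Sidon set in $\mathbb{F}_2^n$. *)

theory Defs
  imports "HOL-Analysis.Analysis" "HOL-Library.Z2"
begin

(* \<open>bit ^ 'n\<close> (with \<open>bit\<close> the two-element field) is the vector space F_2^n for n = CARD('n). *)

definition Sidon :: "(bit ^ 'n::finite) set \<Rightarrow> bool" where
  "Sidon S \<longleftrightarrow>
     \<not> (\<exists>x\<in>S. \<exists>y\<in>S. \<exists>z\<in>S. \<exists>w\<in>S. distinct [x, y, z, w] \<and> x + y = z + w)"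

definition s_max :: "'n::finite itself \<Rightarrow> nat" where
  "s_max _ = Max (card ` {S :: (bit ^ 'n) set. Sidon S})"

instance bit :: finite
proof
  have "(UNIV :: bit set) \<subseteq> {0, 1}"
    by (metis bit_not_one_iff insertCI subsetI)
  then show "finite (UNIV :: bit set)"
    by (rule finite_subset) simp
qed

(* The maximum in \<open>s_max\<close> is over a finite nonempty set, so it is a genuine one. *)

lemma Sidon_card_le_s_max:
  fixes S :: "(bit ^ 'n::finite) set"
  assumes "Sidon S"
  shows "card S \<le> s_max TYPE('n)"
  unfolding s_max_def using assms by (intro Max_ge) auto

lemma s_max_attained:
  "\<exists>S :: (bit ^ 'n::finite) set. Sidon S \<and> card S = s_max TYPE('n)"
proof -
  have "Sidon ({} :: (bit ^ 'n) set)"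
    by (simp add: Sidon_def)
  then have "s_max TYPE('n) \<in> card ` {S :: (bit ^ 'n) set. Sidon S}"
    unfolding s_max_def by (intro Max_in) auto
  then show ?thesis
    by auto
qed

end

theory Submission
  imports Defs
begin

text \<open>
  The proof is a double count that sharpens the Johnson bound from coding theory. Put
  \<open>q = 2 ^ ((n + 1) div 2)\<close> and suppose that some Sidon set has more than \<open>q - 3\<close> elements; discarding
  points leaves a Sidon set \<open>S\<close> with exactly \<open>q - 2\<close>. The hypothesis on \<open>n\<close> makes \<open>q\<close> a power of 4
  with \<open>q \<ge> 16\<close>, so \<open>q\<close> is even and \<open>1\<close> modulo \<open>3\<close>.

  Let \<open>T\<close> (below \<open>missed S\<close>) be the complement of \<open>S + S\<close>. The Sidon property makes the sums of
  two distinct elements of \<open>S\<close> pairwise different, which gives \<open>2 |T| = 5 q - 8\<close>. For a point \<open>x\<close>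
  let \<open>gap S x\<close> be the set of those \<open>a \<in> S\<close> with \<open>x + a \<in> T\<close>. It is empty for \<open>x \<in> S\<close>. For
  \<open>x \<notin> S\<close> the rest of \<open>S\<close> splits into disjoint triples with sum \<open>x\<close> (\<open>gap_decomposition\<close>); hence
  \<open>card (gap S x)\<close> is \<open>2\<close> modulo \<open>3\<close>. If it equals \<open>2\<close>, then the number \<open>(q - 4) / 3\<close> of triples is
  even, so the triples contribute nothing to the sum \<open>s\<close> of all elements of \<open>S\<close>, and the two
  elements of the gap must add up to \<open>s\<close> (\<open>card_gap_cases\<close>).

  The gap sizes add up to \<open>|S| |T|\<close>, too small for \<open>5\<close> or more at every point off \<open>S\<close>: at least
  \<open>(4 q + 2) / 3\<close> points have a gap of size \<open>2\<close>. In particular \<open>s = a + b\<close> for some distinct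
  \<open>a, b \<in> S\<close>, and by the Sidon property every gap of size \<open>2\<close> is this very pair \<open>{a, b}\<close>. So each such
  point \<open>x\<close> yields an element \<open>x + a\<close> of \<open>T\<close> whose translate \<open>x + b\<close> by \<open>s\<close> is again in \<open>T\<close>: the
  sets \<open>T\<close> and \<open>T + s\<close> have a large intersection. On the other hand, for every other \<open>c \<in> S\<close> the
  gap of \<open>c + s\<close> avoids \<open>a\<close>, hence has at least \<open>5\<close> elements, and each of them produces an element of
  \<open>T\<close> outside \<open>T + s\<close> (\<open>card_missed_off_translate\<close>). This leaves room for at most \<open>6\<close> elements in
  the intersection, a contradiction.
\<close>

section \<open>Arithmetic in characteristic two\<close>

lemma vec_bit_add_self [simp]: "(x :: bit ^ 'n::finite) + x = 0"
  by (simp add: vec_eq_iff)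

lemma vec_bit_add_cancel [simp]:
  "(x :: bit ^ 'n::finite) + (x + y) = y" "x + (y + x) = y" "x + y + x = y" "x + y + y = x"
proof -
  show *: "x + (x + y) = y" for x y :: "bit ^ 'n"
    by (simp add: add.assoc[symmetric])
  show "x + (y + x) = y"
    unfolding add.commute[of y x] by (rule *)
  show "x + y + x = y"
    unfolding add.commute[of "x + y" x] by (rule *)
  show "x + y + y = x"
    by (simp add: add.assoc)
qed

lemma vec_bit_add_eq_iff: "(x :: bit ^ 'n::finite) + y = z \<longleftrightarrow> x = y + z"
  by (auto simp: add.commute[of x y])

lemma vec_bit_add_eq_0_iff [simp]: "(x :: bit ^ 'n::finite) + y = 0 \<longleftrightarrow> x = y"
  by (simp add: vec_bit_add_eq_iff)

lemma CARD_bit [simp]: "CARD(bit) = 2"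
proof -
  have "(UNIV :: bit set) = {0, 1}"
    using bit_not_one_iff by blast
  then have "CARD(bit) = card {0, 1 :: bit}" by simp
  then show ?thesis by simp
qed

lemma card_add_card_Compl: "card (A :: (bit ^ 'n::finite) set) + card (- A) = 2 ^ CARD('n)"
proof -
  have "CARD(bit ^ 'n) = card A + card (- A)"
    unfolding Compl_partition[of A, symmetric] by (rule card_Un_disjoint) auto
  then show ?thesis
    unfolding CARD_vec CARD_bit by (rule sym)
qed

section \<open>Sidon sets and their sums of two elements\<close>

lemma Sidon_subset: "Sidon S \<Longrightarrow> R \<subseteq> S \<Longrightarrow> Sidon R"
  unfolding Sidon_def by blast

text \<open>
  The definition of a Sidon set speaks of four distinct points. In characteristic two this is
  enough to make a nonzero sum determine its pair of summands: two pairs that share one point and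
  have the same sum coincide.
\<close>
lemma Sidon_add_eqD:
  assumes "Sidon S" "a \<in> S" "b \<in> S" "c \<in> S" "d \<in> S" "a + b = c + d" "a \<noteq> b"
  shows "{a, b} = {c, d}"
proof (rule ccontr)
  assume ne: "{a, b} \<noteq> {c, d}"
  have cd: "c \<noteq> d"
    using assms(6,7) by (metis vec_bit_add_eq_0_iff)
  have "a \<noteq> c" "a \<noteq> d" "b \<noteq> c" "b \<noteq> d"
    using ne assms(6) by (auto simp: add.commute insert_commute)
  then have "distinct [a, b, c, d]"
    using cd assms(7) by simp
  then show False
    using assms(1-6) unfolding Sidon_def by blast
qed

lemma card_sum_representations_le_2:
  fixes S :: "(bit ^ 'n::finite) set"
  assumes S: "Sidon S" and y: "y \<noteq> 0"
  shows "card {p \<in> S \<times> S. fst p + snd p = y} \<le> 2" (is "card ?Y \<le> 2")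
proof (cases "?Y = {}")
  case True
  then show ?thesis by (simp only: card.empty)
next
  case False
  then obtain p where p: "p \<in> ?Y" by (meson all_not_in_conv)
  define c d where "c = fst p" and "d = snd p"
  then have cd: "c \<in> S" "d \<in> S" "c + d = y" using p by auto
  have "?Y \<subseteq> {(c, d), (d, c)}"
  proof (rule subrelI)
    fix c' d' assume "(c', d') \<in> ?Y"
    then have cd': "c' \<in> S" "d' \<in> S" "c' + d' = y" by auto
    then have "c' \<noteq> d'" using y by auto
    then have "{c', d'} = {c, d}"
      using cd cd' by (intro Sidon_add_eqD[OF S]) simp_all
    then show "(c', d') \<in> {(c, d), (d, c)}"
      by (auto simp: doubleton_eq_iff)
  qed
  then have "card ?Y \<le> card {(c, d), (d, c)}"
    by (rule card_mono[rotated]) simp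
  moreover have "card {(c, d), (d, c)} \<le> 2"
    using card_length[of "[(c, d), (d, c)]"]
    by (simp only: list.set list.size)
  ultimately show ?thesis by (rule le_trans)
qed

definition missed :: "(bit ^ 'n::finite) set \<Rightarrow> (bit ^ 'n) set" where
  "missed S = {y. \<forall>a\<in>S. \<forall>b\<in>S. y \<noteq> a + b}"

text \<open>
  The elements of \<open>S\<close> that are left out when the rest of \<open>S\<close> is grouped into triples with sum \<open>x\<close>;
  see \<open>gap_decomposition\<close>.
\<close>
definition gap :: "(bit ^ 'n::finite) set \<Rightarrow> bit ^ 'n \<Rightarrow> (bit ^ 'n) set" where
  "gap S x = {a \<in> S. x + a \<in> missed S}"

lemma add_notin_missed: "a \<in> S \<Longrightarrow> b \<in> S \<Longrightarrow> a + b \<notin> missed S"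
  by (auto simp: missed_def)

lemma gap_eq_empty: "x \<in> S \<Longrightarrow> gap S x = {}"
  by (auto simp: gap_def missed_def)

text \<open>
  Besides \<open>0\<close>, the set \<open>S + S\<close> consists of one sum for each two-element subset of \<open>S\<close>.
\<close>
lemma card_missed:
  fixes S :: "(bit ^ 'n::finite) set"
  assumes "Sidon S" "S \<noteq> {}"
  shows "card (missed S) + (card S choose 2) + 1 = 2 ^ CARD('n)"
proof -
  let ?P = "{A. A \<subseteq> S \<and> card A = 2}"
  have inj: "inj_on \<Sum> ?P"
  proof (rule inj_onI)
    fix A B assume *: "A \<in> ?P" "B \<in> ?P" "\<Sum> A = \<Sum> B"
    from * obtain a b where A: "A = {a, b}" "a \<noteq> b" by (auto simp: card_2_iff)
    from * obtain c d where B: "B = {c, d}" "c \<noteq> d" by (auto simp: card_2_iff)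
    show "A = B"
      using * A B Sidon_add_eqD[OF assms(1), of a b c d] by auto
  qed
  have zero: "0 \<notin> \<Sum> ` ?P"
    by (auto simp: card_2_iff)
  have "- missed S = insert 0 (\<Sum> ` ?P)"
  proof (intro equalityI subsetI)
    fix y assume "y \<in> - missed S"
    then obtain a b where ab: "a \<in> S" "b \<in> S" "y = a + b" by (auto simp: missed_def)
    show "y \<in> insert 0 (\<Sum> ` ?P)"
    proof (cases "a = b")
      case False
      then have "y = \<Sum> {a, b}" "{a, b} \<in> ?P" using ab by auto
      then show ?thesis by blast
    qed (use ab in simp)
  next
    fix y assume y: "y \<in> insert 0 (\<Sum> ` ?P)"
    show "y \<in> - missed S"
    proof (cases "y = 0")
      case True
      then show ?thesis using assms(2) by (force simp: missed_def)
    next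
      case False
      with y obtain a b where "a \<in> S" "b \<in> S" "y = a + b" by (auto simp: card_2_iff)
      then show ?thesis unfolding missed_def by blast
    qed
  qed
  then have "card (- missed S) = Suc (card (\<Sum> ` ?P))"
    using zero by simp
  also have "card (\<Sum> ` ?P) = card S choose 2"
    using inj by (simp add: card_image n_subsets)
  finally have c: "card (- missed S) = Suc (card S choose 2)" .
  show ?thesis
    using card_add_card_Compl[of "missed S"] unfolding c by simp
qed

section \<open>Gaps\<close>

text \<open>
  Both sides count the pairs of an \<open>a \<in> S\<close> and a missed point \<open>x + a\<close>.
\<close>
lemma sum_card_gap:
  fixes S :: "(bit ^ 'n::finite) set"
  shows "(\<Sum>x\<in>UNIV. card (gap S x)) = card S * card (missed S)"
proof -
  have "(\<Sum>x\<in>UNIV. card (gap S x)) = (\<Sum>a\<in>S. card {x\<in>UNIV. x + a \<in> missed S})"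
    unfolding gap_def by (rule sum_multicount_gen) auto
  also have "\<dots> = (\<Sum>a\<in>S. card (missed S))"
  proof (rule sum.cong[OF refl])
    fix a
    have "{x\<in>UNIV. x + a \<in> missed S} = (\<lambda>y. y + a) ` missed S"
      by (auto intro!: image_eqI[where x = "_ + a"])
    then show "card {x\<in>UNIV. x + a \<in> missed S} = card (missed S)"
      by (simp add: card_image)
  qed
  finally show ?thesis by simp
qed

text \<open>
  An \<open>a \<in> S\<close> outside the gap satisfies \<open>x + a = b + c\<close> with \<open>b, c \<in> S\<close>. As \<open>x \<notin> S\<close>, the points
  \<open>a, b, c\<close> are distinct, and the Sidon property says that \<open>{a, b, c}\<close> is the only triple with
  sum \<open>x\<close> that contains \<open>a\<close>. So the triples with sum \<open>x\<close> partition the complement of the gap in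
  \<open>S\<close>. Counting this partition gives the first equation, summing over it the second.
\<close>
lemma gap_decomposition:
  fixes S :: "(bit ^ 'n::finite) set"
  assumes S: "Sidon S" and x: "x \<notin> S"
  obtains t where "card S = card (gap S x) + 3 * t"
    and "\<Sum> S = \<Sum> (gap S x) + (if even t then 0 else x)"
proof -
  define F where "F = {A. A \<subseteq> S \<and> card A = 3 \<and> \<Sum> A = x}"
  have F_triple: "\<exists>b c. A = {a, b, c} \<and> b \<in> S \<and> c \<in> S \<and> a \<noteq> b \<and> a \<noteq> c \<and> b \<noteq> c \<and> b + c = a + x"
    if "A \<in> F" "a \<in> A" for A a
  proof -
    have "card (A - {a}) = 2" using that by (simp add: F_def)
    then obtain b c where bc: "A - {a} = {b, c}" "b \<noteq> c" by (auto simp: card_2_iff)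
    then have A: "A = {a, b, c}" "a \<noteq> b" "a \<noteq> c" using that by auto
    have "a + (b + c) = x" using that A bc by (auto simp: F_def)
    then have "b + c = a + x" by (metis vec_bit_add_cancel(1))
    with A bc that show ?thesis by (auto simp: F_def)
  qed
  have disj: "A \<inter> B = {}" if "A \<in> F" "B \<in> F" "A \<noteq> B" for A B
  proof (rule ccontr)
    assume "A \<inter> B \<noteq> {}"
    then obtain a where "a \<in> A" "a \<in> B" by auto
    from F_triple[OF \<open>A \<in> F\<close> \<open>a \<in> A\<close>] F_triple[OF \<open>B \<in> F\<close> \<open>a \<in> B\<close>]
    obtain b c b' c' where "A = {a, b, c}" "B = {a, b', c'}" "{b, c} = {b', c'}"
      using Sidon_add_eqD[OF S] by metis
    then show False using that by simp
  qed
  have Un: "\<Union> F = S - gap S x"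
  proof (intro equalityI subsetI)
    fix a assume "a \<in> \<Union> F"
    then obtain A where A: "A \<in> F" "a \<in> A" by blast
    obtain b c where "b \<in> S" "c \<in> S" "b + c = a + x"
      using F_triple[OF A] by blast
    then have "x + a \<notin> missed S"
      by (metis add.commute add_notin_missed)
    then show "a \<in> S - gap S x" using A by (auto simp: F_def gap_def)
  next
    fix a assume a: "a \<in> S - gap S x"
    then obtain b c where bc: "b \<in> S" "c \<in> S" "x + a = b + c"
      by (auto simp: gap_def missed_def)
    have "a \<noteq> x" using a x by auto
    then have "b \<noteq> c" using bc by auto
    moreover have "a \<noteq> b" "a \<noteq> c"
      using bc x by (auto simp: add.commute)
    moreover have "a + (b + c) = x"
      using bc(3) by (metis add.commute vec_bit_add_cancel(1))
    ultimately have "{a, b, c} \<in> F"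
      using a bc by (simp add: F_def)
    then show "a \<in> \<Union> F" by blast
  qed
  have pd: "pairwise disjnt F"
    by (auto simp: pairwise_def disjnt_def dest: disj)
  have "card (\<Union> F) = (\<Sum>A\<in>F. card A)"
    by (rule card_Union_disjoint[OF pd]) simp
  also have "\<dots> = 3 * card F"
    by (simp add: F_def)
  finally have card: "card (\<Union> F) = 3 * card F" .
  have "\<Sum> (\<Union> F) = (\<Sum>A\<in>F. \<Sum> A)"
    using sum.Union_disjoint[of F "\<lambda>x. x"] disj by auto
  also have "\<dots> = (\<Sum>A\<in>F. x)"
    by (simp add: F_def)
  also have "\<dots> = (if even (card F) then 0 else x)"
  proof -
    have "(\<Sum>A\<in>G. x) = (if even (card G) then 0 else x)" if "finite G" for G :: "(bit ^ 'n) set set"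
      using that by induction (auto simp del: sum_constant)
    then show ?thesis by simp
  qed
  finally have sum: "\<Sum> (\<Union> F) = (if even (card F) then 0 else x)" .
  have sub: "gap S x \<subseteq> S" by (auto simp: gap_def)
  show ?thesis
  proof
    show "card S = card (gap S x) + 3 * card F"
      using card_Diff_subset[OF _ sub] card_mono[OF _ sub] card Un by simp
    show "\<Sum> S = \<Sum> (gap S x) + (if even (card F) then 0 else x)"
      using sum.subset_diff[OF sub, of "\<lambda>x. x"] sum Un by (simp add: add.commute)
  qed
qed

text \<open>
  Here the arithmetic of \<open>q\<close> enters. Modulo \<open>3\<close> it leaves only the gap sizes \<open>2, 5, 8, \<dots>\<close>. A gap of size
  \<open>2\<close> belongs to \<open>t = (q - 4) / 3\<close> triples; this is even because \<open>q\<close> is, so the sums of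
  the triples cancel.
\<close>
lemma card_gap_cases:
  fixes S :: "(bit ^ 'n::finite) set"
  assumes S: "Sidon S" and card_S: "card S + 2 = q" and q: "q mod 3 = 1" "even q"
    and x: "x \<notin> S"
  shows "card (gap S x) \<ge> 5 \<or> card (gap S x) = 2 \<and> \<Sum> (gap S x) = \<Sum> S"
proof -
  obtain t where t: "card S = card (gap S x) + 3 * t"
    "\<Sum> S = \<Sum> (gap S x) + (if even t then 0 else x)"
    using gap_decomposition[OF S x] by blast
  have "card (gap S x) mod 3 = 2"
    using t(1) card_S q(1) by presburger
  then have "card (gap S x) = 2 \<or> card (gap S x) \<ge> 5"
    by presburger
  then show ?thesis
  proof
    assume 2: "card (gap S x) = 2"
    then have "even t" using t(1) card_S q(2) by presburger
    then show ?thesis using 2 t(2) by simp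
  qed simp
qed

text \<open>
  If \<open>d\<close> is in the gap of \<open>c + s\<close> with \<open>c \<in> S\<close>, then \<open>z = c + d + s\<close> is missed, while its translate
  \<open>z + s = c + d\<close> is not. A given \<open>z\<close> arises from at most two pairs \<open>(c, d)\<close>, since \<open>z + s\<close> is a
  nonzero sum of two elements of \<open>S\<close>. The condition on \<open>s\<close> excludes \<open>z = s\<close>, for which every
  \<open>c = d\<close> would be a representation.
\<close>
lemma card_missed_off_translate:
  fixes S :: "(bit ^ 'n::finite) set"
  assumes S: "Sidon S" and C: "C \<subseteq> S" and s: "s \<notin> missed S"
    and k: "\<And>c. c \<in> C \<Longrightarrow> k \<le> card (gap S (c + s))"
  shows "card C * k \<le> 2 * card {z \<in> missed S. z + s \<notin> missed S}"
proof -
  let ?D = "{z \<in> missed S. z + s \<notin> missed S}"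
  let ?X = "SIGMA c : C. gap S (c + s)"
  let ?Y = "\<lambda>z. {p \<in> S \<times> S. fst p + snd p = z + s}"
  have "card C * k = (\<Sum>c\<in>C. k)"
    by simp
  also have "\<dots> \<le> (\<Sum>c\<in>C. card (gap S (c + s)))"
    by (rule sum_mono[OF k])
  also have "\<dots> = card ?X" by simp
  also have "\<dots> \<le> card (\<Union>z\<in>?D. ?Y z)"
  proof (rule card_mono)
    show "?X \<subseteq> (\<Union>z\<in>?D. ?Y z)"
    proof (rule subrelI)
      fix c d assume "(c, d) \<in> ?X"
      then have cd: "c \<in> S" "d \<in> S" and T: "c + s + d \<in> missed S"
        using C by (auto simp: gap_def)
      from T have "c + d + s \<in> missed S" by (simp only: ac_simps)
      then have "c + d + s \<in> ?D"
        using add_notin_missed[OF cd] by simp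
      moreover have "(c, d) \<in> ?Y (c + d + s)" using cd by simp
      ultimately show "(c, d) \<in> (\<Union>z\<in>?D. ?Y z)" by (rule UN_I)
    qed
  qed simp
  also have "\<dots> \<le> (\<Sum>z\<in>?D. card (?Y z))"
    by (rule card_UN_le) simp
  also have "\<dots> \<le> (\<Sum>z\<in>?D. 2)"
  proof (rule sum_mono)
    fix z assume "z \<in> ?D"
    then have "z \<noteq> s" using s by blast
    then show "card (?Y z) \<le> 2"
      by (intro card_sum_representations_le_2[OF S]) simp
  qed
  finally show ?thesis by simp
qed

section \<open>The double count\<close>

text \<open>
  The intersection of \<open>missed S\<close> with its translate by the sum \<open>s\<close> of \<open>S\<close> is bounded in two ways:
  from below by the number of gaps of size \<open>2\<close>, which a small average gap size forces, and from
  above through the large gaps of the points \<open>c + s\<close> with \<open>c \<in> S\<close>.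
\<close>
lemma no_Sidon_set_of_card:
  fixes S :: "(bit ^ 'n::finite) set"
  assumes S: "Sidon S" and card_S: "card S + 2 = q"
    and q: "q\<^sup>2 = 2 * 2 ^ CARD('n)" "q mod 3 = 1" "even q"
    and "q \<ge> 8"
  shows False
proof -
  let ?N = "int (card S)" and ?T = "missed S"
  have "S \<noteq> {}" using card_S \<open>q \<ge> 8\<close> by auto
  then obtain M where M: "card S = Suc M"
    using card_S by (metis card_eq_0_iff finite not0_implies_Suc)
  have "even (Suc M * M)" by simp
  then have "2 * (card S choose 2) = Suc M * M"
    unfolding M choose_two by (simp del: mult_Suc)
  then have "int (2 * (card S choose 2)) = int (Suc M * M)"
    by (simp only:)
  moreover have "?N = int M + 1" by (simp add: M)
  ultimately have ch: "2 * int (card S choose 2) = ?N * (?N - 1)"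
    by (simp only: of_nat_mult of_nat_Suc of_nat_numeral add_diff_cancel_left' add.commute)
  have "int (card ?T + (card S choose 2) + 1) = int (2 ^ CARD('n))"
    by (simp only: card_missed[OF S \<open>S \<noteq> {}\<close>])
  then have "int (card ?T) + int (card S choose 2) + 1 = 2 ^ CARD('n)"
    by simp
  moreover have q': "(int q)\<^sup>2 = 2 * 2 ^ CARD('n)"
    using arg_cong[OF q(1), of int] by simp
  moreover have N: "?N = int q - 2" using card_S by simp
  ultimately have card_T: "2 * int (card ?T) = 5 * int q - 8"
    using ch unfolding N by (simp add: algebra_simps power2_eq_square)
  note gap_cases = card_gap_cases[OF S card_S q(2,3)]
  define E where "E = {x. x \<notin> S \<and> card (gap S x) = 2}"
  \<comment> \<open>Gaps of size \<open>5\<close> at all points off \<open>S\<close> would exceed the total; each point of \<open>E\<close> saves \<open>3\<close>.\<close>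
  have E_large: "4 * int q + 2 \<le> 3 * int (card E)"
  proof -
    have "int (card S * card ?T) = (\<Sum>x\<in>UNIV. int (card (gap S x)))"
      by (simp add: sum_card_gap[symmetric])
    also have "\<dots> = (\<Sum>x\<in>-S. int (card (gap S x)))"
      by (rule sum.mono_neutral_right) (auto simp: gap_eq_empty)
    also have "\<dots> \<ge> (\<Sum>x\<in>-S. 5 - 3 * of_bool (x \<in> E))"
      by (rule sum_mono) (use gap_cases in \<open>force simp: E_def\<close>)
    also have "(\<Sum>x\<in>-S. 5 - 3 * of_bool (x \<in> E)) = 5 * int (card (- S)) - 3 * int (card (- S \<inter> E))"
      by (simp add: sum_subtractf sum_distrib_left[symmetric] Int_def)
    also have "- S \<inter> E = E" by (auto simp: E_def)
    also have "int (card (- S)) = 2 ^ CARD('n) - ?N"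
      using arg_cong[OF card_add_card_Compl[of S], of int] by simp
    finally have "10 * 2 ^ CARD('n) - 10 * ?N - 6 * int (card E) \<le> ?N * (2 * int (card ?T))"
      by (simp add: algebra_simps)
    then show ?thesis
      unfolding card_T N using q' by (simp add: algebra_simps power2_eq_square)
  qed
  define s where "s = \<Sum> S"
  have E_sum: "\<exists>c d. gap S x = {c, d} \<and> c \<in> S \<and> d \<in> S \<and> c \<noteq> d \<and> c + d = s" if "x \<in> E" for x
  proof -
    have sum: "\<Sum> (gap S x) = s" and "card (gap S x) = 2"
      using that gap_cases[of x] by (auto simp: E_def s_def)
    then obtain c d where cd: "gap S x = {c, d}" "c \<noteq> d" by (auto simp: card_2_iff)
    moreover have "gap S x \<subseteq> S" by (auto simp: gap_def)
    moreover have "c + d = s" using sum cd by simp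
    ultimately show ?thesis by blast
  qed
  have "E \<noteq> {}" using E_large by auto
  then obtain e where "e \<in> E" by blast
  from E_sum[OF this] obtain a b where ab: "a \<in> S" "b \<in> S" "a \<noteq> b" "a + b = s"
    by (elim exE conjE)
  define W where "W = {y \<in> ?T. y + s \<in> ?T}"
  have gap_E: "gap S x = {a, b}" if x: "x \<in> E" for x
  proof -
    obtain c d where cd: "gap S x = {c, d}" "c \<in> S" "d \<in> S" "c + d = s"
      using E_sum[OF x] by (elim exE conjE)
    then have "{a, b} = {c, d}"
      using ab by (intro Sidon_add_eqD[OF S]) simp_all
    then show ?thesis using cd(1) by simp
  qed
  have "card E \<le> card W"
  proof (rule card_inj_on_le)
    show "inj_on (\<lambda>x. x + a) E" by simp
    show "(\<lambda>x. x + a) ` E \<subseteq> W"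
    proof clarify
      fix x assume "x \<in> E"
      then have "a \<in> gap S x" "b \<in> gap S x" using gap_E by auto
      moreover have "x + a + s = x + b"
        using ab(4) by (metis add.assoc vec_bit_add_cancel(1))
      ultimately show "x + a \<in> W"
        by (simp only: gap_def W_def mem_Collect_eq simp_thms)
    qed
  qed simp
  have large: "card (gap S (c + s)) \<ge> 5" if c: "c \<in> S - {a, b}" for c
  proof -
    \<comment> \<open>Otherwise \<open>s = a + b\<close> would have a second representation, by \<open>c\<close> and \<open>c + s\<close>.\<close>
    have "c + s \<notin> S"
    proof
      assume "c + s \<in> S"
      moreover have "a + b = c + (c + s)" using ab(4) by simp
      ultimately have "{a, b} = {c, c + s}"
        using Sidon_add_eqD[OF S] ab c by blast
      then show False using c by auto
    qed
    moreover have "a \<notin> gap S (c + s)"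
    proof -
      have "c + s + a = c + b"
        using ab(4) by (metis add.assoc add.commute vec_bit_add_cancel(1))
      moreover have "c + b \<notin> ?T"
        using add_notin_missed c ab(2) by blast
      ultimately show ?thesis
        by (simp only: gap_def mem_Collect_eq simp_thms)
    qed
    then have "c + s \<notin> E" using gap_E by blast
    ultimately show ?thesis
      using gap_cases by (auto simp: E_def)
  qed
  have pairs: "card (S - {a, b}) * 5 \<le> 2 * card (?T - W)"
  proof -
    have W: "?T - W = {z \<in> ?T. z + s \<notin> ?T}" by (auto simp: W_def)
    have "s \<notin> ?T"
      unfolding ab(4)[symmetric] using ab(1,2) by (rule add_notin_missed)
    then show ?thesis
      unfolding W by (rule card_missed_off_translate[OF S Diff_subset _ large])
  qed
  \<comment> \<open>The bounds now collide: \<open>2 |?T - W| \<ge> 5 (q - 4)\<close> and \<open>2 |?T| = 5 q - 8\<close> give \<open>|W| \<le> 6\<close>,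
    whereas \<open>3 |W| \<ge> 4 q + 2 \<ge> 34\<close>.\<close>
  have "W \<subseteq> ?T" by (auto simp: W_def)
  then have "card (?T - W) + card W = card ?T"
    using card_mono[of ?T W] by (simp add: card_Diff_subset)
  moreover have "card (S - {a, b}) + 2 = card S"
    using ab card_mono[of S "{a, b}"] by (simp add: card_Diff_subset)
  ultimately show False
    using pairs \<open>card E \<le> card W\<close> E_large card_T card_S \<open>q \<ge> 8\<close> by linarith
qed

theorem theorem1p1:
  fixes n :: nat
  assumes "CARD('n::finite) = n"
    and "n \<ge> 7"
    and "n mod 4 = 3"
  shows "int (s_max TYPE('n)) \<le> 2 ^ ((n + 1) div 2) - 3"
proof (rule ccontr)
  define k where "k = n div 4"
  have n: "n = 4 * k + 3" and "k \<ge> 1"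
    using assms(2,3) unfolding k_def by presburger+
  define q :: nat where "q = 4 ^ (k + 1)"
  have half: "(n + 1) div 2 = 2 * (k + 1)" using n by simp
  have q_half: "2 ^ ((n + 1) div 2) = q"
    unfolding half power_mult q_def by simp
  have "q \<ge> 16"
    using power_increasing[of 2 "k + 1" "4 :: nat"] \<open>k \<ge> 1\<close> by (simp add: q_def)
  have q2: "q\<^sup>2 = 2 * 2 ^ CARD('n)"
    unfolding q_half[symmetric] power_mult[symmetric] half assms(1) n
    by (simp add: power_add power_mult)
  have q3: "q mod 3 = 1"
    unfolding q_def by (simp add: power_mod[of 4 3, symmetric] del: power_Suc)
  obtain S :: "(bit ^ 'n) set" where S: "Sidon S" "card S = s_max TYPE('n)"
    using s_max_attained by blast
  assume "\<not> ?thesis"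
  moreover have "2 ^ ((n + 1) div 2) = int q"
    by (simp flip: q_half)
  ultimately have "q - 2 \<le> card S"
    using S(2) \<open>q \<ge> 16\<close> by linarith
  then obtain R where R: "R \<subseteq> S" "card R = q - 2"
    by (meson obtain_subset_with_card_n)
  show False
  proof (rule no_Sidon_set_of_card)
    show "Sidon R" using S(1) R(1) by (rule Sidon_subset)
    show "card R + 2 = q" using R(2) \<open>q \<ge> 16\<close> by simp
    show "q \<ge> 8" using \<open>q \<ge> 16\<close> by simp
    show "even q" by (simp add: q_def)
  qed (use q2 q3 in auto)
qed

end
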